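(* Let $d\geq 1$ and let $\mathcal P=\{P_1,\dots,P_n\}\subset\mathbf R^d$ be a generic configuration of $n$ points. Define a relation $\sim$ on $\mathcal P$ by: $P\sim Q$ if either $P=Q$ or $$n(P,Q)\equiv \binom{n-3}{d-1}\pmod 2 .$$ Then $\sim$ is an equivalence relation on $\mathcal P$ having at most $2$ equivalence classes.
   Context: A set $\mathcal P=\{P_1,\dots,P_n\}$ of $n$ distinct points in the real affine space $\mathbf R^d$ is a generic configuration if every subset of at most $d+1$ points of $\mathcal P$ is affinely independent. An affine hyperplane $H\subset\mathbf R^d$ separates two points $P,Q\in\mathbf R^d\setminus H$ if $P,Q$ do not lie in the same connected component of $\mathbf R^d\setminus H$. For two distinct points $P,Q$ of a generic configuration $\mathcal P$, $n(P,Q)$ denotes the number of distinct hyperplanes separating $P$ and $Q$ which are affinely spanned by $d$ distinct elements of $\mathcal P\setminus\{P,Q\}$. Convention: $\binom{m}{k}=m(m-1)\cdots(m-k+1)/k!$ for every integer $m$ and $k\ge 0$. *)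

theory Defs
  imports "HOL-Analysis.Analysis" "HOL-Number_Theory.Cong"
begin

definition generic_configuration :: "(real ^ 'd) set \<Rightarrow> bool" where
  "generic_configuration \<P> \<longleftrightarrow>
     finite \<P> \<and> (\<forall>S \<subseteq> \<P>. card S \<le> CARD('d) + 1 \<longrightarrow> \<not> affine_dependent S)"

definition affine_hyperplane :: "(real ^ 'd) set \<Rightarrow> bool" where
  "affine_hyperplane H \<longleftrightarrow> affine H \<and> aff_dim H = int CARD('d) - 1"

definition separates :: "(real ^ 'd) set \<Rightarrow> real ^ 'd \<Rightarrow> real ^ 'd \<Rightarrow> bool" where
  "separates H P Q \<longleftrightarrow>
     affine_hyperplane H \<and> P \<notin> H \<and> Q \<notin> H \<and> \<not> connected_component (- H) P Q"

definition separating_hyperplanes ::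
    "(real ^ 'd) set \<Rightarrow> real ^ 'd \<Rightarrow> real ^ 'd \<Rightarrow> (real ^ 'd) set set" where
  "separating_hyperplanes \<P> P Q =
     {H. separates H P Q \<and>
         (\<exists>S \<subseteq> \<P> - {P, Q}. card S = CARD('d) \<and> H = affine hull S)}"

definition sep_number :: "(real ^ 'd) set \<Rightarrow> real ^ 'd \<Rightarrow> real ^ 'd \<Rightarrow> nat" where
  "sep_number \<P> P Q = card (separating_hyperplanes \<P> P Q)"

text \<open>
  Binomial coefficients with an arbitrary integer upper entry (negative below for configurations
  of fewer than three points). The sort constraint on \<^const>\<open>gbinomial\<close> admits only fields, hence
  a separate integer-valued constant. The division is exact, by the lemma that follows.
\<close>

definition int_binomial :: "int \<Rightarrow> nat \<Rightarrow> int" where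
  "int_binomial m k = (\<Prod>i<k. m - int i) div fact k"

lemma of_int_int_binomial:
  "(of_int (int_binomial m k) :: 'a :: field_char_0) = of_int m gchoose k"
  using of_int_gbinomial [of m k, where ?'a = 'a]
  by (simp add: int_binomial_def lessThan_atLeast0 gbinomial_prod_rev)

definition orchard_relation :: "(real ^ 'd) set \<Rightarrow> ((real ^ 'd) \<times> (real ^ 'd)) set" where
  "orchard_relation \<P> =
     {(P, Q). P \<in> \<P> \<and> Q \<in> \<P> \<and>
        (P = Q \<or>
         [int (sep_number \<P> P Q) = int_binomial (int (card \<P>) - 3) (CARD('d) - 1)] (mod 2))}"

end

theory Submission imports Defs begin

text \<open>
  Write \<open>n(x, y)\<close> for the number of separating hyperplanes, \<open>m\<close> for the number of points and \<open>d\<close>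
  for the dimension. Everything follows from one parity identity: for three distinct points
  \<open>x, y, z\<close> of the configuration,
  \<open>n(x, y) + n(y, z) + n(x, z) \<equiv> binomial (m - 3) (d - 1)\<close> modulo 2
  (lemma \<open>even_sep_number_triple\<close>). It says that an even number of the three pairs are
  inequivalent, that is, that two points inequivalent to a third one are equivalent to each other
  and that the relation is transitive.

  By genericity, distinct \<open>d\<close>-subsets span distinct hyperplanes, so that \<open>n(x, y)\<close> counts
  \<open>d\<close>-subsets. Those that avoid \<open>x\<close>, \<open>y\<close> and \<open>z\<close> are candidates in all three counts;
  the hyperplane of each separates none or exactly two of the pairs, and so contributes an even
  number. The others
  arise by adding one of the points \<open>x, y, z\<close> to a set \<open>T\<close> of \<open>d - 1\<close> further points, and there are
  \<open>binomial (m - 3) (d - 1)\<close> such sets. For a fixed \<open>T\<close>, an odd number of the three hyperplanes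
  through \<open>T\<close> and one of the three points separate the other two points (lemma
  \<open>separates_pencil\<close>). Modulo the directions of \<open>T\<close> this is a statement about three lines
  through the origin of a plane.
\<close>

section \<open>Sides of a hyperplane\<close>

lemma separates_hyperplane_iff:
  fixes a :: "real ^ 'd"
  assumes "a \<noteq> 0"
  shows "separates {x. a \<bullet> x = b} P Q \<longleftrightarrow> (a \<bullet> P - b) * (a \<bullet> Q - b) < 0"
proof -
  let ?H = "{x. a \<bullet> x = b}"
  have hyp: "affine_hyperplane ?H"
    using assms by (simp add: affine_hyperplane_def affine_hyperplane aff_dim_hyperplane)
  have "connected_component (- ?H) P Q \<longleftrightarrow> 0 < (a \<bullet> P - b) * (a \<bullet> Q - b)"
    if "a \<bullet> P \<noteq> b" "a \<bullet> Q \<noteq> b"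
  proof
    assume "connected_component (- ?H) P Q"
    then obtain C where C: "connected C" "C \<subseteq> - ?H" "P \<in> C" "Q \<in> C"
      by (auto simp: connected_component_def)
    have "\<not> (a \<bullet> u \<le> b \<and> b \<le> a \<bullet> v)" if "u \<in> C" "v \<in> C" for u v
      using connected_ivt_hyperplane[OF C(1) that, of a b] C(2) by auto
    from this[of P Q] this[of Q P] C(3,4) that
    have "a \<bullet> P < b \<and> a \<bullet> Q < b \<or> a \<bullet> P > b \<and> a \<bullet> Q > b"
      by linarith
    then show "0 < (a \<bullet> P - b) * (a \<bullet> Q - b)"
      by (auto intro: mult_neg_neg mult_pos_pos)
  next
    assume "0 < (a \<bullet> P - b) * (a \<bullet> Q - b)"
    then consider "a \<bullet> P < b" "a \<bullet> Q < b" | "a \<bullet> P > b" "a \<bullet> Q > b"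
      by (auto simp: zero_less_mult_iff)
    then show "connected_component (- ?H) P Q"
    proof cases
      case 1
      then show ?thesis
        unfolding connected_component_def
        by (intro exI[of _ "{x. a \<bullet> x < b}"])
           (auto simp: convex_halfspace_lt convex_connected)
    next
      case 2
      then show ?thesis
        unfolding connected_component_def
        by (intro exI[of _ "{x. a \<bullet> x > b}"])
           (auto simp: convex_halfspace_gt convex_connected)
    qed
  qed
  then have "\<not> connected_component (- ?H) P Q \<longleftrightarrow> (a \<bullet> P - b) * (a \<bullet> Q - b) < 0"
    if "a \<bullet> P \<noteq> b" "a \<bullet> Q \<noteq> b"
    using that by (metis eq_iff_diff_eq_0 linorder_neqE_linordered_idom mult_eq_0_iff
        order_less_asym)
  with hyp show ?thesis
    unfolding separates_def by (cases "a \<bullet> P = b \<or> a \<bullet> Q = b") auto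
qed

lemma separates_commute: "separates H P Q \<longleftrightarrow> separates H Q P"
  by (auto simp: separates_def connected_component_sym_eq)

lemma sep_number_commute: "sep_number \<P> P Q = sep_number \<P> Q P"
  unfolding sep_number_def separating_hyperplanes_def
  by (simp add: separates_commute[of _ P Q] insert_commute)

text \<open>A hyperplane missing three points separates either none or exactly two of the pairs.\<close>

lemma even_separates_triple:
  fixes H :: "(real ^ 'd) set"
  assumes "affine_hyperplane H" "x \<notin> H" "y \<notin> H" "z \<notin> H"
  shows "even (of_bool (separates H x y) + of_bool (separates H y z)
               + of_bool (separates H x z) :: nat)"
proof -
  have H: "affine hull H = H" "aff_dim H = int (DIM(real ^ 'd) - 1)"
    using assms(1) by (simp_all add: affine_hyperplane_def hull_same of_nat_diff)
  obtain a b where ab': "a \<noteq> 0" "affine hull H = {x. a \<bullet> x = b}"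
    using iffD1[OF aff_dim_eq_hyperplane H(2)] by blast
  note ab = ab'(1) trans[OF H(1)[symmetric] ab'(2)]
  have signs: "p * r < 0 \<longleftrightarrow> (p * q < 0 \<longleftrightarrow> \<not> q * r < 0)"
    if "p \<noteq> 0" "q \<noteq> 0" "r \<noteq> 0" for p q r :: real
    using that by (metis linorder_neqE_linordered_idom mult_less_0_iff order_less_asym)
  have "a \<bullet> x - b \<noteq> 0" "a \<bullet> y - b \<noteq> 0" "a \<bullet> z - b \<noteq> 0"
    using assms(2-4) by (simp_all add: ab(2))
  from signs[OF this] have "separates H x z \<longleftrightarrow> (separates H x y \<longleftrightarrow> \<not> separates H y z)"
    unfolding ab(2) separates_hyperplane_iff[OF ab(1)] .
  then show ?thesis by (cases "separates H x y"; cases "separates H y z") simp_all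
qed

section \<open>Hyperplanes spanned by a generic configuration\<close>

context
  fixes \<P> :: "(real ^ 'd) set"
  assumes generic: "generic_configuration \<P>"
begin

lemma finite_configuration: "finite \<P>"
  using generic by (simp add: generic_configuration_def)

lemma not_in_affine_hull:
  assumes "S \<subseteq> \<P>" "card S = CARD('d)" "x \<in> \<P>" "x \<notin> S"
  shows "x \<notin> affine hull S"
proof -
  have "finite S"
    using assms(1) finite_configuration finite_subset by blast
  then have "\<not> affine_dependent (insert x S)"
    using generic assms by (auto simp: generic_configuration_def)
  moreover have "insert x S - {x} = S"
    using assms(4) by auto
  ultimately show ?thesis
    unfolding affine_dependent_def by (metis insertI1)
qed

lemma aff_dim_spanned:
  assumes "S \<subseteq> \<P>" "card S = CARD('d)"
  shows "aff_dim S = int CARD('d) - 1"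
proof -
  have "\<not> affine_dependent S"
    using generic assms by (auto simp: generic_configuration_def)
  from aff_dim_affine_independent[OF this] assms(2) show ?thesis by simp
qed

lemma affine_hyperplane_spanned:
  assumes "S \<subseteq> \<P>" "card S = CARD('d)"
  shows "affine_hyperplane (affine hull S)"
  using aff_dim_spanned[OF assms] by (simp add: affine_hyperplane_def)

lemma spanned_hyperplane_equation:
  assumes "S \<subseteq> \<P>" "card S = CARD('d)"
  obtains a b where "a \<noteq> 0" "affine hull S = {x. a \<bullet> x = b}"
  using aff_dim_spanned[OF assms] aff_dim_eq_hyperplane[of S] by auto

lemma sep_number_eq_card_subsets:
  "sep_number \<P> x y =
   card {S. S \<subseteq> \<P> - {x, y} \<and> card S = CARD('d) \<and> separates (affine hull S) x y}"
    (is "_ = card ?A")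
proof -
  have "inj_on (\<lambda>S. affine hull S) ?A"
  proof (rule inj_onI)
    fix S S' assume *: "S \<in> ?A" "S' \<in> ?A" "affine hull S = affine hull S'"
    have sub: "U \<subseteq> V" if "U \<in> ?A" "V \<in> ?A" "affine hull U = affine hull V" for U V
    proof
      fix u assume u: "u \<in> U"
      then have "u \<in> affine hull V"
        using that(3) hull_inc by metis
      then show "u \<in> V"
        using not_in_affine_hull[of V u] u that(1,2) by blast
    qed
    show "S = S'"
      using sub[OF *] sub[OF *(2,1) *(3)[symmetric]] by (rule equalityI)
  qed
  moreover have "separating_hyperplanes \<P> x y = (\<lambda>S. affine hull S) ` ?A"
    by (auto simp: separating_hyperplanes_def)
  ultimately show ?thesis
    by (simp add: sep_number_def card_image)
qed

text \<open>
  The three hyperplanes through \<open>T\<close> and one of \<open>x, y, z\<close>. If \<open>f\<close> and \<open>g\<close> are affine functions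
  defining the hyperplanes through \<open>x\<close> and through \<open>y\<close>, then \<open>g(z) f - f(z) g\<close>
  defines the one through \<open>z\<close>; its values at \<open>x\<close> and \<open>y\<close> are \<open>- f(z) g(x)\<close> and \<open>g(z) f(y)\<close>.
\<close>

lemma separates_pencil:
  assumes T: "T \<subseteq> \<P> - {x, y, z}" "card T = CARD('d) - 1"
    and xyz: "x \<in> \<P>" "y \<in> \<P>" "z \<in> \<P>" "x \<noteq> y" "y \<noteq> z" "x \<noteq> z"
  shows "separates (affine hull (insert z T)) x y \<longleftrightarrow>
         (separates (affine hull (insert x T)) y z \<longleftrightarrow>
          separates (affine hull (insert y T)) x z)"
proof -
  have "finite T"
    using T(1) finite_configuration finite_subset by blast
  then have card: "card (insert u T) = CARD('d)" if "u \<in> {x, y, z}" for u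
    using T that by (subst card_insert_disjoint) (auto simp: Suc_diff_1)
  have sub: "insert u T \<subseteq> \<P>" if "u \<in> {x, y, z}" for u
    using T xyz that by auto
  have out: "v \<notin> affine hull (insert u T)" if "u \<in> {x, y, z}" "v \<in> {x, y, z}" "u \<noteq> v" for u v
    using not_in_affine_hull[OF sub[of u] card[of u], of v] T(1) xyz that by auto
  obtain a1 b1 where 1: "a1 \<noteq> 0" "affine hull (insert x T) = {v. a1 \<bullet> v = b1}"
    using spanned_hyperplane_equation[OF sub[of x] card[of x]] by auto
  obtain a2 b2 where 2: "a2 \<noteq> 0" "affine hull (insert y T) = {v. a2 \<bullet> v = b2}"
    using spanned_hyperplane_equation[OF sub[of y] card[of y]] by auto
  define f g where "f = (\<lambda>v. a1 \<bullet> v - b1)" and "g = (\<lambda>v. a2 \<bullet> v - b2)"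
  have f0: "f v = 0" if "v \<in> insert x T" for v
    using hull_inc[OF that, of affine] 1(2) by (simp add: f_def)
  have g0: "g v = 0" if "v \<in> insert y T" for v
    using hull_inc[OF that, of affine] 2(2) by (simp add: g_def)
  have nz: "f y \<noteq> 0" "f z \<noteq> 0" "g x \<noteq> 0" "g z \<noteq> 0"
    using out[of x y] out[of x z] out[of y x] out[of y z] xyz
    by (auto simp: f_def g_def 1(2) 2(2))
  define a3 b3 where "a3 = g z *\<^sub>R a1 - f z *\<^sub>R a2" and "b3 = g z * b1 - f z * b2"
  have h: "a3 \<bullet> v - b3 = g z * f v - f z * g v" for v
    by (simp add: a3_def b3_def f_def g_def algebra_simps inner_diff_left)
  have "a3 \<noteq> 0"
  proof
    assume "a3 = 0"
    then have "g z * f x - f z * g x = g z * f z - f z * g z"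
      using h[of x] h[of z] by simp
    then show False using nz f0[of x] by simp
  qed
  have "insert z T \<subseteq> {v. a3 \<bullet> v = b3}"
  proof
    fix v assume "v \<in> insert z T"
    then have "a3 \<bullet> v - b3 = 0"
      unfolding h using f0[of v] g0[of v] by auto
    then show "v \<in> {v. a3 \<bullet> v = b3}" by simp
  qed
  moreover have "aff_dim (insert z T) = aff_dim {v. a3 \<bullet> v = b3}"
    using aff_dim_spanned[OF sub[of z] card[of z]] \<open>a3 \<noteq> 0\<close> by (simp add: aff_dim_hyperplane)
  ultimately have "affine hull (insert z T) = affine hull {v. a3 \<bullet> v = b3}"
    by (simp add: aff_dim_eq_full_gen)
  then have 3: "affine hull (insert z T) = {v. a3 \<bullet> v = b3}"
    by (simp add: affine_hyperplane affine_hull_eq)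
  have "separates (affine hull (insert z T)) x y \<longleftrightarrow> (- f z * g x) * (g z * f y) < 0"
    unfolding 3 separates_hyperplane_iff[OF \<open>a3 \<noteq> 0\<close>] h using f0[of x] g0[of y] by simp
  moreover have "separates (affine hull (insert x T)) y z \<longleftrightarrow> f y * f z < 0"
    unfolding 1(2) separates_hyperplane_iff[OF 1(1)] by (simp add: f_def)
  moreover have "separates (affine hull (insert y T)) x z \<longleftrightarrow> g x * g z < 0"
    unfolding 2(2) separates_hyperplane_iff[OF 2(1)] by (simp add: g_def)
  moreover have "(- f z * g x) * (g z * f y) < 0 \<longleftrightarrow> 0 < (f y * f z) * (g x * g z)"
    by (simp add: ac_simps)
  moreover have "0 < p * q \<longleftrightarrow> (p < 0 \<longleftrightarrow> q < 0)" if "p \<noteq> 0" "q \<noteq> 0" for p q :: real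
    using that by (auto simp: zero_less_mult_iff)
  from this[of "f y * f z" "g x * g z"]
  have "0 < (f y * f z) * (g x * g z) \<longleftrightarrow> (f y * f z < 0 \<longleftrightarrow> g x * g z < 0)"
    using nz by simp
  ultimately show ?thesis by blast
qed

section \<open>The parity identity for triples\<close>

text \<open>
  The subsets counted by \<open>n(x, y)\<close>, split according to whether they contain a third point \<open>z\<close>.
\<close>

lemma sep_number_split:
  assumes "z \<in> \<P>" "z \<noteq> x" "z \<noteq> y"
  shows "sep_number \<P> x y =
    (\<Sum>S | S \<subseteq> \<P> - {x, y, z} \<and> card S = CARD('d). of_bool (separates (affine hull S) x y)) +
    (\<Sum>T | T \<subseteq> \<P> - {x, y, z} \<and> card T = CARD('d) - 1.
       of_bool (separates (affine hull (insert z T)) x y))"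
    (is "_ = sum _ ?D + sum _ ?E")
proof -
  let ?s = "\<lambda>S. separates (affine hull S) x y"
  have fin: "finite (\<P> - {x, y, z})" using finite_configuration by simp
  have finD: "finite ?D" and finE: "finite ?E"
    using fin by simp_all
  have finS: "finite S" "z \<notin> S" if "S \<subseteq> \<P> - {x, y, z}" for S
    using that fin finite_subset by blast+
  have "{S. S \<subseteq> \<P> - {x, y} \<and> card S = CARD('d) \<and> ?s S} =
        {S \<in> ?D. ?s S} \<union> insert z ` {T \<in> ?E. ?s (insert z T)}" (is "?L = ?A \<union> ?B")
  proof (intro equalityI subsetI)
    fix S assume S: "S \<in> ?L"
    show "S \<in> ?A \<union> ?B"
    proof (cases "z \<in> S")
      case True
      then have "S = insert z (S - {z})" by auto
      moreover have "S - {z} \<in> {T \<in> ?E. ?s (insert z T)}"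
        using S True by (auto simp: insert_absorb)
      ultimately show ?thesis by blast
    next
      case False
      then show ?thesis using S by auto
    qed
  next
    fix S assume "S \<in> ?A \<union> ?B"
    then consider "S \<in> ?A" | T where "T \<in> ?E" "?s (insert z T)" "S = insert z T"
      by blast
    then show "S \<in> ?L"
    proof cases
      case 1
      then show ?thesis by blast
    next
      case 2
      then have "card S = CARD('d)"
        using finS[of T] by (simp add: Suc_diff_1)
      then show ?thesis using 2 assms by auto
    qed
  qed
  moreover have "card (?A \<union> ?B) = card ?A + card ?B"
  proof (rule card_Un_disjoint)
    show "finite ?A" by (rule finite_subset[OF _ finD]) blast
    show "finite ?B" by (intro finite_imageI finite_subset[OF _ finE]) blast
    show "?A \<inter> ?B = {}" by blast
  qed
  moreover have "inj_on (insert z) {T \<in> ?E. ?s (insert z T)}"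
    by (rule inj_onI) (use finS(2) insert_ident in blast)
  ultimately have "sep_number \<P> x y = card {S \<in> ?D. ?s S} + card {T \<in> ?E. ?s (insert z T)}"
    by (simp only: sep_number_eq_card_subsets card_image)
  then show ?thesis
    using finD finE by (simp add: Int_def)
qed

lemma even_sep_number_triple:
  assumes xyz: "x \<in> \<P>" "y \<in> \<P>" "z \<in> \<P>" "x \<noteq> y" "y \<noteq> z" "x \<noteq> z"
  shows "even (sep_number \<P> x y + sep_number \<P> y z + sep_number \<P> x z
               + ((card \<P> - 3) choose (CARD('d) - 1)))"
proof -
  define W where "W = \<P> - {x, y, z}"
  define D where "D = {S. S \<subseteq> W \<and> card S = CARD('d)}"
  define E where "E = {T. T \<subseteq> W \<and> card T = CARD('d) - 1}"
  define s :: "(real ^ 'd) set \<Rightarrow> real ^ 'd \<Rightarrow> real ^ 'd \<Rightarrow> nat"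
    where "s S u v = of_bool (separates (affine hull S) u v)" for S u v
  have finW: "finite W" and cW: "card W = card \<P> - 3"
    using finite_configuration xyz by (auto simp: W_def card_Diff_subset)
  have "sep_number \<P> x y = (\<Sum>S\<in>D. s S x y) + (\<Sum>T\<in>E. s (insert z T) x y)"
    using sep_number_split[of z x y] xyz unfolding D_def E_def W_def s_def by simp
  moreover have "sep_number \<P> y z = (\<Sum>S\<in>D. s S y z) + (\<Sum>T\<in>E. s (insert x T) y z)"
    using sep_number_split[of x y z] xyz unfolding D_def E_def W_def s_def
    by (simp add: insert_commute)
  moreover have "sep_number \<P> x z = (\<Sum>S\<in>D. s S x z) + (\<Sum>T\<in>E. s (insert y T) x z)"
    using sep_number_split[of y x z] xyz unfolding D_def E_def W_def s_def
    by (simp add: insert_commute)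
  moreover have "(card \<P> - 3) choose (CARD('d) - 1) = (\<Sum>T\<in>E. 1)"
    using n_subsets[OF finW, of "CARD('d) - 1"] by (simp add: E_def cW)
  ultimately have "sep_number \<P> x y + sep_number \<P> y z + sep_number \<P> x z
      + ((card \<P> - 3) choose (CARD('d) - 1)) =
      (\<Sum>S\<in>D. s S x y + s S y z + s S x z) +
      (\<Sum>T\<in>E. s (insert z T) x y + s (insert x T) y z + s (insert y T) x z + 1)"
    by (simp only: sum.distrib ac_simps)
  moreover have "even (\<Sum>S\<in>D. s S x y + s S y z + s S x z)"
  proof (rule dvd_sum)
    fix S assume "S \<in> D"
    then have S: "S \<subseteq> \<P>" "card S = CARD('d)" "x \<notin> S" "y \<notin> S" "z \<notin> S"
      by (auto simp: D_def W_def)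
    show "even (s S x y + s S y z + s S x z)"
      unfolding s_def
      by (intro even_separates_triple affine_hyperplane_spanned not_in_affine_hull S xyz)
  qed
  moreover have
    "even (\<Sum>T\<in>E. s (insert z T) x y + s (insert x T) y z + s (insert y T) x z + 1)"
  proof (rule dvd_sum)
    fix T assume "T \<in> E"
    then have "T \<subseteq> \<P> - {x, y, z}" "card T = CARD('d) - 1"
      by (auto simp: E_def W_def)
    from separates_pencil[OF this xyz]
    show "even (s (insert z T) x y + s (insert x T) y z + s (insert y T) x z + 1)"
      by (auto simp: s_def)
  qed
  ultimately show ?thesis by simp
qed

end

section \<open>The orchard relation\<close>

lemma int_binomial_of_nat: "int_binomial (int m) k = int (m choose k)"
proof -
  have "(of_int (int_binomial (int m) k) :: real) = of_int (int (m choose k))"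
    by (simp add: of_int_int_binomial binomial_gbinomial)
  then show ?thesis by (simp only: of_int_eq_iff)
qed

lemma orchard_relation_iff:
  fixes x y :: "real ^ 'd"
  assumes "x \<in> \<P>" "y \<in> \<P>" "x \<noteq> y" "3 \<le> card \<P>"
  shows "(x, y) \<in> orchard_relation \<P> \<longleftrightarrow>
         even (sep_number \<P> x y + ((card \<P> - 3) choose (CARD('d) - 1)))"
proof -
  have "int (card \<P>) - 3 = int (card \<P> - 3)"
    using assms(4) by simp
  then have "int_binomial (int (card \<P>) - 3) (CARD('d) - 1) =
        int ((card \<P> - 3) choose (CARD('d) - 1))"
    by (simp only: int_binomial_of_nat)
  then show ?thesis
    using assms(1-3) unfolding orchard_relation_def
    by (simp add: cong_iff_dvd_diff)
qed

lemma orchard_relation_triple: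
  assumes gen: "generic_configuration \<P>"
    and xyz: "x \<in> \<P>" "y \<in> \<P>" "z \<in> \<P>" "x \<noteq> y" "y \<noteq> z" "x \<noteq> z"
  shows "(x, z) \<in> orchard_relation \<P> \<longleftrightarrow>
         ((x, y) \<in> orchard_relation \<P> \<longleftrightarrow> (y, z) \<in> orchard_relation \<P>)"
proof -
  have "card {x, y, z} \<le> card \<P>"
    using xyz finite_configuration[OF gen] by (intro card_mono) auto
  then have "3 \<le> card \<P>" using xyz by simp
  then show ?thesis
    using even_sep_number_triple[OF gen xyz] xyz by (auto simp: orchard_relation_iff)
qed

lemma equiv_orchard_relation:
  assumes gen: "generic_configuration \<P>"
  shows "equiv \<P> (orchard_relation \<P>)"
proof (rule equivI)
  show "orchard_relation \<P> \<subseteq> \<P> \<times> \<P>" "refl_on \<P> (orchard_relation \<P>)"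
    by (auto simp: orchard_relation_def refl_on_def)
  show "sym (orchard_relation \<P>)"
    by (auto simp: orchard_relation_def sym_def sep_number_commute)
  show "trans (orchard_relation \<P>)"
  proof (rule transI)
    fix x y z assume *: "(x, y) \<in> orchard_relation \<P>" "(y, z) \<in> orchard_relation \<P>"
    then have "x \<in> \<P>" "y \<in> \<P>" "z \<in> \<P>"
      by (auto simp: orchard_relation_def)
    then show "(x, z) \<in> orchard_relation \<P>"
      using * orchard_relation_triple[OF gen, of x y z]
      by (cases "x = y \<or> y = z \<or> x = z") (auto simp: orchard_relation_def)
  qed
qed

theorem theorem1p1:
  fixes \<P> :: "(real ^ 'd) set"
  assumes "generic_configuration \<P>"
  shows "equiv \<P> (orchard_relation \<P>) \<and> card (\<P> // orchard_relation \<P>) \<le> 2"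
proof
  let ?R = "orchard_relation \<P>"
  show eq: "equiv \<P> ?R"
    using assms by (rule equiv_orchard_relation)
  show "card (\<P> // ?R) \<le> 2"
  proof (rule ccontr)
    assume "\<not> card (\<P> // ?R) \<le> 2"
    then have "3 \<le> card (\<P> // ?R)" by simp
    then obtain \<C> where "\<C> \<subseteq> \<P> // ?R" "card \<C> = 3"
      by (meson obtain_subset_with_card_n)
    then obtain A B C where "A \<in> \<P> // ?R" "B \<in> \<P> // ?R" "C \<in> \<P> // ?R"
      and "A \<noteq> B" "B \<noteq> C" "A \<noteq> C"
      by (auto simp: card_3_iff)
    then obtain x y z where xyz: "x \<in> \<P>" "y \<in> \<P>" "z \<in> \<P>"
      and "?R `` {x} \<noteq> ?R `` {y}" "?R `` {y} \<noteq> ?R `` {z}" "?R `` {x} \<noteq> ?R `` {z}"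
      by (auto elim!: quotientE)
    then have "(x, y) \<notin> ?R" "(y, z) \<notin> ?R" "(x, z) \<notin> ?R" "x \<noteq> y" "y \<noteq> z" "x \<noteq> z"
      using eq_equiv_class_iff[OF eq] by auto
    then show False
      using orchard_relation_triple[OF assms xyz] by blast
  qed
qed

end
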